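(* Let $E$ be a complex Banach space, let $I=\mathbb{R}$ or $I=[0,\infty)$, and let $f\in C_b(I:E)$. Then $f$ is semi-anti-periodic if and only if there exists a sequence $(f_n)$ of anti-periodic functions in $C_b(I:E)$ such that $\lim_{n\to\infty}f_n(x)=f(x)$ uniformly in $x\in I$.
   Context: $C_b(I:E)$ is the space of bounded continuous functions $I\to E$. Set $\mathbb{S}:=\mathbb{N}$ if $I=[0,\infty)$ and $\mathbb{S}:=\mathbb{Z}$ if $I=\mathbb{R}$. A function $f:I\to E$ is anti-periodic if there exists $p>0$ such that $f(x+p)=-f(x)$ for all $x\in I$ (the number $p$ may depend on $f$). A function $f\in C_b(I:E)$ is semi-anti-periodic if for every $\varepsilon>0$ there exists $p>0$ such that for all $m\in\mathbb{S}$ and all $x\in I$ one has $\|f(x+mp)-(-1)^m f(x)\|\le\varepsilon$. *)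

theory Defs
  imports "HOL-Analysis.Analysis"
begin

text \<open>
  Complex Banach spaces: the library class \<open>banach\<close> is real. We add a multiplication by complex
  scalars that satisfies the complex vector space axioms, extends the given real scalar
  multiplication, and for which the given norm is homogeneous.
\<close>

class complex_banach = banach +
  fixes scaleC :: "complex \<Rightarrow> 'a \<Rightarrow> 'a"  (infixr \<open>*\<^sub>C\<close> 75)
  assumes scaleC_add_right: "a *\<^sub>C (x + y) = a *\<^sub>C x + a *\<^sub>C y"
    and scaleC_add_left: "(a + b) *\<^sub>C x = a *\<^sub>C x + b *\<^sub>C x"
    and scaleC_scaleC: "a *\<^sub>C b *\<^sub>C x = (a * b) *\<^sub>C x"
    and scaleC_of_real: "complex_of_real r *\<^sub>C x = r *\<^sub>R x"
    and norm_scaleC: "norm (a *\<^sub>C x) = cmod a * norm x"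

instantiation complex :: complex_banach
begin

definition scaleC_complex :: "complex \<Rightarrow> complex \<Rightarrow> complex"
  where "scaleC_complex a x = a * x"

instance
  by standard (simp_all add: scaleC_complex_def algebra_simps norm_mult scaleR_conv_of_real)

end

text \<open>
  A function \<open>I \<rightarrow> E\<close> is represented by a total function on the reals; every notion below
  depends only on its values on \<open>I\<close>.
\<close>

definition Cb :: "real set \<Rightarrow> (real \<Rightarrow> 'e::complex_banach) set"
  where "Cb I = {f. continuous_on I f \<and> bounded (f ` I)}"

text \<open>
  The set \<open>\<S>\<close>, as a set of integers. It is only meant for \<open>I = \<real>\<close> and \<open>I = [0,\<infinity>)\<close>. The number
  0 is included in the second case; whether it is makes no difference in the definition of
  semi-anti-periodicity, where the condition for \<open>m = 0\<close> always holds.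
\<close>

definition multipliers :: "real set \<Rightarrow> int set"
  where "multipliers I = (if I = UNIV then UNIV else range int)"

definition anti_periodic_on :: "real set \<Rightarrow> (real \<Rightarrow> 'e::complex_banach) \<Rightarrow> bool"
  where "anti_periodic_on I f \<longleftrightarrow> (\<exists>p>0. \<forall>x\<in>I. f (x + p) = - f x)"

definition semi_anti_periodic_on :: "real set \<Rightarrow> (real \<Rightarrow> 'e::complex_banach) \<Rightarrow> bool"
  where "semi_anti_periodic_on I f \<longleftrightarrow> f \<in> Cb I \<and>
    (\<forall>\<epsilon>>0. \<exists>p>0. \<forall>m\<in>multipliers I. \<forall>x\<in>I.
      norm (f (x + of_int m * p) - ((-1) powi m) *\<^sub>C f x) \<le> \<epsilon>)"

end

theory Submission
  imports Defs
begin

text \<open>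
  If \<open>g\<close> is anti-periodic with anti-period \<open>p\<close>, then \<open>g (x + m p) = (-1)\<^sup>m g x\<close> exactly, so a
  function within \<open>\<epsilon>/2\<close> of \<open>g\<close> satisfies the same relation up to \<open>\<epsilon>\<close>; hence uniform limits of
  anti-periodic functions are semi-anti-periodic.

  Conversely, let \<open>p\<close> be a number witnessing semi-anti-periodicity of \<open>f\<close> for \<open>\<epsilon>\<close>. Such a \<open>p\<close>
  controls all translates \<open>f (x + m p)\<close> at once, with an error that does not grow with \<open>m\<close>, so
  \<open>f\<close> is determined up to \<open>\<epsilon>\<close> by its restriction to \<open>[0, p]\<close>. This restriction does not quite
  extend to a continuous function with anti-period \<open>p\<close>, because \<open>f p\<close> need not equal \<open>- f 0\<close>. The
  case \<open>m = 1\<close> bounds the defect \<open>f 0 + f p\<close> by \<open>\<epsilon>\<close>, and subtracting the linear term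
  \<open>(t / p) (f 0 + f p)\<close> removes it at the cost of another \<open>\<epsilon>\<close>. The anti-periodic extension of the
  corrected function is continuous (\<open>continuous_on_anti_extension\<close>) and within \<open>2 \<epsilon>\<close> of \<open>f\<close>.
\<close>

lemma scaleC_minus_one_powi:
  "((-1) powi m) *\<^sub>C x = ((-1) powi m :: real) *\<^sub>R (x :: 'e::complex_banach)"
  by (simp flip: scaleC_of_real add: of_real_power_int)

lemma norm_minus_one_powi_scaleR [simp]:
  "norm (((-1) powi m :: real) *\<^sub>R x) = norm (x :: 'e::real_normed_vector)"
  by (simp add: norm_power_int power_int_abs)

lemma translate_mem_interval:
  assumes "I = UNIV \<or> I = {0..}" "p > 0" "m \<in> multipliers I" "x \<in> I"
  shows "x + of_int m * p \<in> I"
  using assms by (auto simp: multipliers_def split: if_splits)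

lemma anti_periodic_translate:
  fixes g :: "real \<Rightarrow> 'e::real_normed_vector"
  assumes I: "I = UNIV \<or> I = {0..}" and p: "p > 0"
    and g: "\<And>x. x \<in> I \<Longrightarrow> g (x + p) = - g x"
    and m: "m \<in> multipliers I" and x: "x \<in> I"
  shows "g (x + of_int m * p) = ((-1) powi m :: real) *\<^sub>R g x"
proof -
  have forward: "g (y + of_nat n * p) = ((-1) ^ n :: real) *\<^sub>R g y" if "y \<in> I" for n y
  proof (induction n)
    case (Suc n)
    have "y + of_nat n * p \<in> I"
      using I p that by auto
    then have "g (y + of_nat n * p + p) = - g (y + of_nat n * p)"
      by (rule g)
    with Suc show ?case
      by (simp add: algebra_simps)
  qed simp
  show ?thesis
  proof (cases m rule: int_cases2)
    case (nonneg n)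
    with forward[OF x, of n] show ?thesis
      by simp
  next
    case (nonpos n)
    show ?thesis
    proof (cases "I = UNIV")
      case True
      \<comment> \<open>A backward translation is undone by a forward one, and the sign is its own inverse.\<close>
      with forward[of "x - of_nat n * p" n] have "g x = ((-1) ^ n :: real) *\<^sub>R g (x - of_nat n * p)"
        by simp
      then have "((-1) ^ n :: real) *\<^sub>R g x = g (x - of_nat n * p)"
        by (simp flip: power_add mult_2)
      then show ?thesis
        using nonpos by (simp add: power_int_minus flip: power_inverse)
    next
      case False
      with m nonpos have "m = 0"
        by (auto simp: multipliers_def)
      then show ?thesis
        by simp
    qed
  qed
qed

lemma semi_anti_periodic_on_if_approximable:
  fixes f :: "real \<Rightarrow> 'e::complex_banach"
  assumes I: "I = UNIV \<or> I = {0..}" and f: "f \<in> Cb I"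
    and approx: "\<And>\<epsilon>. \<epsilon> > 0 \<Longrightarrow> \<exists>g. anti_periodic_on I g \<and> (\<forall>x\<in>I. norm (g x - f x) \<le> \<epsilon>)"
  shows "semi_anti_periodic_on I f"
  unfolding semi_anti_periodic_on_def
proof (intro conjI allI impI f)
  fix \<epsilon> :: real assume "\<epsilon> > 0"
  then obtain g where "anti_periodic_on I g" and fg: "\<And>x. x \<in> I \<Longrightarrow> norm (g x - f x) \<le> \<epsilon> / 2"
    using approx[of "\<epsilon> / 2"] by auto
  then obtain p where p: "p > 0" and g: "\<And>x. x \<in> I \<Longrightarrow> g (x + p) = - g x"
    by (auto simp: anti_periodic_on_def)
  show "\<exists>p>0. \<forall>m\<in>multipliers I. \<forall>x\<in>I.
      norm (f (x + of_int m * p) - ((-1) powi m) *\<^sub>C f x) \<le> \<epsilon>"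
  proof (intro exI[of _ p] conjI ballI)
    fix m x assume m: "m \<in> multipliers I" and x: "x \<in> I"
    let ?s = "(-1) powi m :: real" and ?y = "x + of_int m * p"
    have "norm (f ?y - ?s *\<^sub>R f x) = norm (?s *\<^sub>R (g x - f x) - (g ?y - f ?y))"
      using anti_periodic_translate[of I p g, OF I p g m x] by (simp add: algebra_simps)
    also have "\<dots> \<le> norm (g x - f x) + norm (g ?y - f ?y)"
      by (metis norm_triangle_ineq4 norm_minus_one_powi_scaleR)
    also have "\<dots> \<le> \<epsilon>"
      using fg[OF x] fg[OF translate_mem_interval[OF I p m x]] by simp
    finally show "norm (f ?y - ((-1) powi m) *\<^sub>C f x) \<le> \<epsilon>"
      by (simp add: scaleC_minus_one_powi)
  qed (rule p)
qed

definition anti_extension :: "real \<Rightarrow> (real \<Rightarrow> 'e::real_normed_vector) \<Rightarrow> real \<Rightarrow> 'e"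
  where "anti_extension p h x = ((-1) powi \<lfloor>x / p\<rfloor> :: real) *\<^sub>R h (x - of_int \<lfloor>x / p\<rfloor> * p)"

lemma floor_remainder_bounds:
  fixes p x :: real
  assumes "p > 0"
  shows "0 \<le> x - of_int \<lfloor>x / p\<rfloor> * p" "x - of_int \<lfloor>x / p\<rfloor> * p < p"
  using assms floor_divide_lower[of p x] floor_divide_upper[of p x] by (simp_all add: algebra_simps)

lemma anti_extension_add:
  assumes "p > 0"
  shows "anti_extension p h (x + p) = - anti_extension p h x"
proof -
  have "\<lfloor>(x + p) / p\<rfloor> = \<lfloor>x / p\<rfloor> + 1"
    using assms by (simp add: add_divide_distrib)
  then show ?thesis
    by (simp add: anti_extension_def power_int_add algebra_simps)
qed

text \<open>
  The matching condition makes the formula for the \<open>k\<close>-th period valid also at the right endpoint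
  of that period, where the floor already jumps to \<open>k + 1\<close>.
\<close>

lemma anti_extension_on_period:
  assumes p: "p > 0" and match: "h p = - h 0"
    and x: "of_int k * p \<le> x" "x \<le> of_int (k + 1) * p"
  shows "anti_extension p h x = ((-1) powi k :: real) *\<^sub>R h (x - of_int k * p)"
proof (cases "x = of_int (k + 1) * p")
  case True
  then have "\<lfloor>x / p\<rfloor> = k + 1"
    using p by simp
  then show ?thesis
    using True match by (simp add: anti_extension_def power_int_add algebra_simps)
next
  case False
  then have "\<lfloor>x / p\<rfloor> = k"
    using x p by (intro floor_unique) (auto simp: field_simps)
  then show ?thesis
    by (simp add: anti_extension_def)
qed

lemma continuous_on_anti_extension:
  assumes p: "p > 0" and match: "h p = - h 0" and h: "continuous_on {0..p} h"
  shows "continuous_on UNIV (anti_extension p h)"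
proof -
  have period: "continuous_on {of_int k * p..of_int (k + 1) * p} (anti_extension p h)" for k
  proof -
    have "continuous_on {of_int k * p..of_int (k + 1) * p}
        (\<lambda>x. ((-1) powi k :: real) *\<^sub>R h (x - of_int k * p))"
      by (intro continuous_intros continuous_on_compose2[OF h]) (auto simp: algebra_simps)
    then show ?thesis
      by (rule continuous_on_eq) (use anti_extension_on_period[of p h, OF p match] in auto)
  qed
  have "isCont (anti_extension p h) x" for x
  proof -
    define k where "k = \<lfloor>x / p\<rfloor>"
    \<comment> \<open>Every point is interior to the union of its period with the preceding one.\<close>
    have split: "{of_int (k - 1) * p..of_int (k + 1) * p} =
        {of_int (k - 1) * p..of_int k * p} \<union> {of_int k * p..of_int (k + 1) * p}"
      using p by (subst ivl_disj_un_two_touch) (auto simp: algebra_simps)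
    have "continuous_on {of_int (k - 1) * p..of_int (k + 1) * p} (anti_extension p h)"
      unfolding split using period[of "k - 1"] period[of k] by (intro continuous_on_closed_Un) auto
    moreover have "x \<in> interior {of_int (k - 1) * p..of_int (k + 1) * p}"
      using floor_remainder_bounds[OF p, of x] p by (simp add: k_def algebra_simps)
    ultimately show ?thesis
      by (rule continuous_on_interior)
  qed
  then show ?thesis
    by (simp add: continuous_on_eq_continuous_at)
qed

lemma bounded_range_anti_extension:
  assumes p: "p > 0" and h: "continuous_on {0..p} h"
  shows "bounded (range (anti_extension p h))"
proof -
  have "bounded (h ` {0..p})"
    using h by (intro compact_imp_bounded compact_continuous_image) auto
  then obtain B where B: "\<And>t. t \<in> {0..p} \<Longrightarrow> norm (h t) \<le> B"
    unfolding bounded_iff by blast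
  have "norm (anti_extension p h x) \<le> B" for x
    using B[of "x - of_int \<lfloor>x / p\<rfloor> * p"] floor_remainder_bounds[OF p, of x]
    by (simp add: anti_extension_def)
  then show ?thesis
    by (auto simp: bounded_iff)
qed

lemma semi_anti_periodic_on_imp_approximable:
  fixes f :: "real \<Rightarrow> 'e::complex_banach"
  assumes I: "I = UNIV \<or> I = {0..}" and f: "semi_anti_periodic_on I f" and "\<epsilon> > 0"
  shows "\<exists>g. g \<in> Cb I \<and> anti_periodic_on I g \<and> (\<forall>x\<in>I. norm (g x - f x) \<le> \<epsilon>)"
proof -
  have "\<epsilon> / 2 > 0"
    using \<open>\<epsilon> > 0\<close> by simp
  then obtain p where p: "p > 0"
    and fp: "\<And>m x. m \<in> multipliers I \<Longrightarrow> x \<in> I \<Longrightarrow>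
      norm (f (x + of_int m * p) - ((-1) powi m :: real) *\<^sub>R f x) \<le> \<epsilon> / 2"
    using f unfolding semi_anti_periodic_on_def scaleC_minus_one_powi by blast
  have sub: "{0..p} \<subseteq> I"
    using I by auto
  define d where "d = f 0 + f p"
  define h where "h t = f t - (t / p) *\<^sub>R d" for t
  define g where "g = anti_extension p h"
  have "1 \<in> multipliers I" "0 \<in> I"
    using I by (auto simp: multipliers_def image_iff intro: exI[of _ "1::nat"])
  from fp[OF this] have d: "norm d \<le> \<epsilon> / 2"
    by (simp add: d_def add.commute)
  have match: "h p = - h 0"
    using p by (simp add: h_def d_def)
  have "continuous_on {0..p} f"
    using f sub by (auto simp: semi_anti_periodic_on_def Cb_def intro: continuous_on_subset)
  then have h: "continuous_on {0..p} h"
    unfolding h_def using p by (intro continuous_intros) auto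
  have "g \<in> Cb I"
    using continuous_on_subset[OF continuous_on_anti_extension[OF p match h], of I]
      bounded_subset[OF bounded_range_anti_extension[OF p h], of "g ` I"]
    by (auto simp: Cb_def g_def)
  moreover have "anti_periodic_on I g"
    using p anti_extension_add by (auto simp: anti_periodic_on_def g_def)
  moreover have "norm (g x - f x) \<le> \<epsilon>" if x: "x \<in> I" for x
  proof -
    define k where "k = \<lfloor>x / p\<rfloor>"
    define t where "t = x - of_int k * p"
    let ?s = "(-1) powi k :: real"
    have t: "0 \<le> t" "t \<le> p"
      using floor_remainder_bounds[OF p, of x] by (auto simp: t_def k_def)
    have k: "k \<in> multipliers I"
    proof (cases "I = UNIV")
      case False
      then have "0 \<le> k"
        using I x p by (auto simp: k_def)
      then show ?thesis
        using False by (auto simp: multipliers_def image_iff intro: zero_le_imp_eq_int)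
    qed (simp add: multipliers_def)
    have "g x - f x = - (?s *\<^sub>R ((t / p) *\<^sub>R d)) - (f (t + of_int k * p) - ?s *\<^sub>R f t)"
      by (simp add: g_def anti_extension_def h_def t_def k_def algebra_simps)
    then have "norm (g x - f x) \<le>
        norm ((t / p) *\<^sub>R d) + norm (f (t + of_int k * p) - ?s *\<^sub>R f t)"
      by (metis norm_triangle_ineq4 norm_minus_cancel norm_minus_one_powi_scaleR)
    also have "norm ((t / p) *\<^sub>R d) \<le> norm d"
      using t p mult_left_le_one_le[of "norm d" "t / p"] by simp
    also have "norm (f (t + of_int k * p) - ?s *\<^sub>R f t) \<le> \<epsilon> / 2"
      using fp[OF k] t sub by auto
    finally show ?thesis
      using d by simp
  qed
  ultimately show ?thesis
    by blast
qed

theorem proposition2p8: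
  fixes I :: "real set" and f :: "real \<Rightarrow> 'e::complex_banach"
  assumes "I = UNIV \<or> I = {0..}"
    and "f \<in> Cb I"
  shows "semi_anti_periodic_on I f \<longleftrightarrow>
    (\<exists>fs :: nat \<Rightarrow> real \<Rightarrow> 'e. (\<forall>n. fs n \<in> Cb I \<and> anti_periodic_on I (fs n)) \<and>
      uniform_limit I fs f sequentially)"
proof
  assume "semi_anti_periodic_on I f"
  then have "\<exists>g. g \<in> Cb I \<and> anti_periodic_on I g \<and>
      (\<forall>x\<in>I. norm (g x - f x) \<le> inverse (real (Suc n)))" for n
    by (rule semi_anti_periodic_on_imp_approximable[OF assms(1)]) simp
  then obtain fs where fs: "\<And>n. fs n \<in> Cb I \<and> anti_periodic_on I (fs n)"
    and close: "\<And>n x. x \<in> I \<Longrightarrow> norm (fs n x - f x) \<le> inverse (real (Suc n))"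
    by metis
  have "uniform_limit I fs f sequentially"
  proof (rule uniform_limitI)
    fix e :: real assume "e > 0"
    then have "eventually (\<lambda>n. inverse (real (Suc n)) < e) sequentially"
      by (rule order_tendstoD(2)[OF LIMSEQ_inverse_real_of_nat])
    then show "eventually (\<lambda>n. \<forall>x\<in>I. dist (fs n x) (f x) < e) sequentially"
      by eventually_elim (auto simp only: dist_norm intro: le_less_trans[OF close])
  qed
  with fs show "\<exists>fs. (\<forall>n. fs n \<in> Cb I \<and> anti_periodic_on I (fs n)) \<and>
      uniform_limit I fs f sequentially"
    by blast
next
  assume "\<exists>fs. (\<forall>n. fs n \<in> Cb I \<and> anti_periodic_on I (fs n)) \<and>
      uniform_limit I fs f sequentially"
  then obtain fs where fs: "\<And>n. anti_periodic_on I (fs n)" and lim: "uniform_limit I fs f sequentially"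
    by blast
  show "semi_anti_periodic_on I f"
  proof (rule semi_anti_periodic_on_if_approximable[OF assms])
    fix \<epsilon> :: real assume "\<epsilon> > 0"
    then have "eventually (\<lambda>n. \<forall>x\<in>I. dist (fs n x) (f x) < \<epsilon>) sequentially"
      by (rule uniform_limitD[OF lim])
    then obtain n where "\<forall>x\<in>I. dist (fs n x) (f x) < \<epsilon>"
      using eventually_happens'[OF sequentially_bot] by blast
    with fs show "\<exists>g. anti_periodic_on I g \<and> (\<forall>x\<in>I. norm (g x - f x) \<le> \<epsilon>)"
      by (auto simp: dist_norm intro: less_imp_le)
  qed
qed

end
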